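(* Let $n\ge 3$, let $F\subseteq E(K_n)$ be a set of $p\ge 1$ edges of the complete graph $K_n$, and assume that $K_n-F$ is connected. Then $$Kf(K_n-F)\ge n-1+\frac{2p}{n-2}.$$ Equality holds if and only if $H_F\cong pK_2$.
   Context: $K_n-F$ is the graph on the vertices of $K_n$ obtained by deleting the edges in $F$. The deletion graph of $F$ is $H_F=(V(F),F)$ with $V(F)=\bigcup_{e\in F}e$ (the set of endpoints of edges of $F$). $pK_2$ is the disjoint union of $p$ single edges. For a connected graph $G$ with Laplacian $L(G)=D(G)-A(G)$, the effective resistance between distinct vertices is $R_G(x,y)=(e_x-e_y)^TL(G)^+(e_x-e_y)$ ($L(G)^+$ the Moore--Penrose inverse, $e_x$ the standard basis vector of vertex $x$), and the Kirchhoff index is $Kf(G)=\sum_{\{x,y\}}R_G(x,y)$, the sum over all unordered pairs of distinct vertices. *)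

theory Defs
  imports "HOL-Analysis.Analysis"
begin

text \<open>A graph is a pair of a vertex set and a set of edges, each edge being a two-element
  set of vertices.\<close>

type_synonym 'v ugraph = "'v set \<times> 'v set set"

definition verts :: "'v ugraph \<Rightarrow> 'v set" where
  "verts G = fst G"

definition edges :: "'v ugraph \<Rightarrow> 'v set set" where
  "edges G = snd G"

definition unordered_pairs :: "'v set \<Rightarrow> 'v set set" where
  "unordered_pairs V = {{x, y} |x y. x \<in> V \<and> y \<in> V \<and> x \<noteq> y}"

definition complete_graph :: "'v set \<Rightarrow> 'v ugraph" where
  "complete_graph V = (V, unordered_pairs V)"

definition delete_edges :: "'v ugraph \<Rightarrow> 'v set set \<Rightarrow> 'v ugraph" where
  "delete_edges G F = (verts G, edges G - F)"

definition deletion_graph :: "'v set set \<Rightarrow> 'v ugraph" where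
  "deletion_graph F = (\<Union>F, F)"

definition connected_graph :: "'v ugraph \<Rightarrow> bool" where
  "connected_graph G \<longleftrightarrow> verts G \<noteq> {} \<and>
     (\<forall>x\<in>verts G. \<forall>y\<in>verts G. (x, y) \<in> {(u, v). {u, v} \<in> edges G}\<^sup>*)"

definition graph_iso :: "'v ugraph \<Rightarrow> 'w ugraph \<Rightarrow> bool" where
  "graph_iso G H \<longleftrightarrow> (\<exists>f. bij_betw f (verts G) (verts H) \<and>
     (\<forall>x\<in>verts G. \<forall>y\<in>verts G. {x, y} \<in> edges G \<longleftrightarrow> {f x, f y} \<in> edges H))"

text \<open>The graph \<open>p K\<^sub>2\<close>: the \<open>i\<close>-th copy of \<open>K\<^sub>2\<close> has the vertices \<open>(i, False)\<close> and \<open>(i, True)\<close>.\<close>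

definition disjoint_K2s :: "nat \<Rightarrow> (nat \<times> bool) ugraph" where
  "disjoint_K2s p = ({..<p} \<times> UNIV, {{(i, False), (i, True)} |i. i < p})"

definition degree :: "'v ugraph \<Rightarrow> 'v \<Rightarrow> nat" where
  "degree G x = card {e \<in> edges G. x \<in> e}"

text \<open>Matrices are indexed by the whole vertex type. A type element outside \<open>verts G\<close> would give a
  zero row and column of the Laplacian, and hence of its Moore--Penrose inverse, so it does not
  affect the effective resistances between vertices of \<open>G\<close>.\<close>

definition degree_matrix :: "'v::finite ugraph \<Rightarrow> real^'v^'v" where
  "degree_matrix G = (\<chi> x y. if x = y then real (degree G x) else 0)"

definition adjacency_matrix :: "'v::finite ugraph \<Rightarrow> real^'v^'v" where
  "adjacency_matrix G = (\<chi> x y. if {x, y} \<in> edges G then 1 else 0)"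

definition laplacian :: "'v::finite ugraph \<Rightarrow> real^'v^'v" where
  "laplacian G = degree_matrix G - adjacency_matrix G"

text \<open>The four Penrose conditions, which every real matrix satisfies with exactly one \<open>X\<close>.\<close>

definition is_moore_penrose_inverse :: "real^'n^'m \<Rightarrow> real^'m^'n \<Rightarrow> bool" where
  "is_moore_penrose_inverse A X \<longleftrightarrow>
     A ** X ** A = A \<and> X ** A ** X = X \<and>
     transpose (A ** X) = A ** X \<and> transpose (X ** A) = X ** A"

definition moore_penrose_inverse :: "real^'n^'m \<Rightarrow> real^'m^'n" where
  "moore_penrose_inverse A = (THE X. is_moore_penrose_inverse A X)"

definition effective_resistance :: "'v::finite ugraph \<Rightarrow> 'v \<Rightarrow> 'v \<Rightarrow> real" where
  "effective_resistance G x y =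
     (axis x 1 - axis y 1) \<bullet> (moore_penrose_inverse (laplacian G) *v (axis x 1 - axis y 1))"

lemma effective_resistance_commute: "effective_resistance G x y = effective_resistance G y x"
proof -
  have "effective_resistance G y x =
      (- (axis x 1 - axis y 1)) \<bullet>
        (moore_penrose_inverse (laplacian G) *v (- (axis x 1 - axis y 1)))"
    unfolding effective_resistance_def by simp
  also have "\<dots> = effective_resistance G x y"
    unfolding effective_resistance_def
    by (simp only: linear_neg[OF matrix_vector_mul_linear] inner_minus_left inner_minus_right
        minus_minus)
  finally show ?thesis by simp
qed

text \<open>The effective resistance as a function of an unordered pair, well defined by symmetry.\<close>

definition pair_resistance :: "'v::finite ugraph \<Rightarrow> 'v set \<Rightarrow> real" where
  "pair_resistance G e = (THE r. \<exists>x y. e = {x, y} \<and> r = effective_resistance G x y)"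

lemma pair_resistance_eq: "pair_resistance G {x, y} = effective_resistance G x y"
  unfolding pair_resistance_def
  by (rule the_equality) (use effective_resistance_commute[of G] in \<open>auto simp: doubleton_eq_iff\<close>)

definition kirchhoff_index :: "'v::finite ugraph \<Rightarrow> real" where
  "kirchhoff_index G = (\<Sum>e\<in>unordered_pairs (verts G). pair_resistance G e)"

end

theory Submission
  imports Defs
begin

text \<open>
  Let \<open>H\<close> be the Laplacian of the deleted edges on all \<open>n\<close> vertices, \<open>J\<close> the all-ones matrix and
  \<open>L = n I - J - H\<close> the Laplacian of \<open>K\<^sub>n - F\<close>. By connectivity \<open>L + J = n I - H\<close> is positive definite;
  with inverse \<open>N\<close>, the Moore--Penrose inverse of \<open>L\<close> is \<open>N - J / n\<^sup>2\<close>, so the Kirchhoff index is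
  \<open>n tr N - 1 = n - 1 + tr (H N)\<close>. The function \<open>\<mu> / (n - \<mu>)\<close> lies above its quadratic Hermite
  interpolant at \<open>0, 2, 2\<close>, whose \<open>\<mu>\<^sup>2\<close>-coefficient is positive. Applied to \<open>H\<close>, with
  \<open>tr H = 2 p\<close> and \<open>tr H\<^sup>2 = \<Sum> d\<^sup>2 + \<Sum> d \<ge> 4 p\<close> for the degrees \<open>d\<close> in \<open>F\<close>, this gives the bound.
  Equality forces \<open>d \<le> 1\<close> everywhere; conversely a matching satisfies \<open>H\<^sup>2 = 2 H\<close>, which determines
  \<open>tr (H N)\<close>.
\<close>

section \<open>Matrix algebra, positivity of traces, and uniqueness of the Moore--Penrose
  inverse\<close>

section \<open>Matrices\<close>

lemma matrix_add_rdistrib: "(A + B) ** C = A ** C + B ** C"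
  for A B :: "'a::semiring_1^'n^'m"
  by (simp add: vec_eq_iff matrix_matrix_mult_def sum.distrib distrib_right)

lemma matrix_diff_ldistrib: "A ** (B - C) = A ** B - A ** C"
  for A :: "'a::ring_1^'n^'m"
  by (simp add: vec_eq_iff matrix_matrix_mult_def sum_subtractf right_diff_distrib)

lemma matrix_diff_rdistrib: "(A - B) ** C = A ** C - B ** C"
  for A B :: "'a::ring_1^'n^'m"
  by (simp add: vec_eq_iff matrix_matrix_mult_def sum_subtractf left_diff_distrib)

lemma matrix_scaleR_left: "(c *\<^sub>R A) ** B = c *\<^sub>R (A ** B)"
  for A :: "real^'n^'m"
  by (simp add: scalar_matrix_assoc)

lemma matrix_scaleR_right: "A ** (c *\<^sub>R B) = c *\<^sub>R (A ** B)"
  for A :: "real^'n^'m"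
  by (simp add: matrix_scalar_ac matrix_scaleR_left)

lemmas matrix_mult_expand = matrix_add_ldistrib matrix_add_rdistrib matrix_diff_ldistrib
  matrix_diff_rdistrib matrix_scaleR_left matrix_scaleR_right

lemma trace_scaleR: "trace (c *\<^sub>R A) = c * trace A" for A :: "real^'n^'n"
  by (simp add: trace_def sum_distrib_left)

lemma inner_matrix_vector_transpose: "u \<bullet> (A *v v) = (transpose A *v u) \<bullet> v"
  for A :: "real^'n^'m"
  by (simp add: dot_lmul_matrix)

text \<open>Each diagonal entry is the quadratic form of \<open>P\<close> evaluated at a column of
  \<open>B\<close>.\<close>

lemma trace_congruence_nonneg:
  fixes P :: "real^'n^'n" and B :: "real^'m^'n"
  assumes "\<And>v. 0 \<le> v \<bullet> (P *v v)"
  shows "0 \<le> trace (transpose B ** P ** B)"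
proof -
  have "(transpose B ** P ** B) $ i $ i = column i B \<bullet> (P *v column i B)" for i
  proof -
    have "(transpose B ** P ** B) $ i $ i = axis i 1 \<bullet> ((transpose B ** P ** B) *v axis i 1)"
      by (simp add: inner_axis' matrix_vector_mult_basis column_def)
    also have "\<dots> = (B *v axis i 1) \<bullet> (P *v (B *v axis i 1))"
      by (simp only: matrix_vector_mul_assoc[symmetric] inner_matrix_vector_transpose[of _ "transpose B"]
          transpose_transpose)
    finally show ?thesis by (simp add: matrix_vector_mult_basis)
  qed
  then show ?thesis
    unfolding trace_def using assms by (simp add: sum_nonneg)
qed

text \<open>
  This is \<open>tr (N H (H - 2)\<^sup>2) \<ge> 0\<close>. Positivity needs no simultaneous diagonalization, because
  \<open>c N H = H + H N H\<close>.
\<close>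

lemma trace_psd_resolvent_ge:
  fixes H N :: "real^'n^'n"
  assumes "transpose H = H" and comm: "H ** N = N ** H"
    and resolvent: "c *\<^sub>R N = mat 1 + H ** N" and "c > 0"
    and H_psd: "\<And>v. 0 \<le> v \<bullet> (H *v v)" and N_psd: "\<And>v. 0 \<le> v \<bullet> (N *v v)"
  shows "(c - 4) * trace H + trace (H ** H) \<le> (c - 2)\<^sup>2 * trace (H ** N)"
proof -
  define B where "B = H - 2 *\<^sub>R mat 1"
  have symB: "transpose B = B"
    using \<open>transpose H = H\<close> by (simp add: B_def vec_eq_iff transpose_def mat_def)
  \<comment> \<open>Left multiplication of the resolvent identity by a power of \<open>H\<close>
    yields the recurrence \<open>c * t_k = tr H^k + t_(k+1)\<close> for
    \<open>t_k = tr (H^k N)\<close>.\<close>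
  have expand: "c *\<^sub>R (A ** N) = A + A ** H ** N" for A
  proof -
    have "c *\<^sub>R (A ** N) = A ** (c *\<^sub>R N)" by (simp add: matrix_scaleR_right)
    then show ?thesis unfolding resolvent by (simp add: matrix_add_ldistrib matrix_mul_assoc)
  qed
  let ?t1 = "trace (H ** N)" and ?t2 = "trace (H ** H ** N)" and ?t3 = "trace (H ** H ** H ** N)"
    and ?t4 = "trace (H ** H ** H ** H ** N)"
  have t1: "c * ?t1 = trace H + ?t2"
    using arg_cong[OF expand[of H], of trace] by (simp add: trace_scaleR trace_add)
  have t2: "c * ?t2 = trace (H ** H) + ?t3"
    using arg_cong[OF expand[of "H ** H"], of trace] by (simp add: trace_scaleR trace_add)
  have t3: "c * ?t3 = trace (H ** H ** H) + ?t4"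
    using arg_cong[OF expand[of "H ** H ** H"], of trace] by (simp add: trace_scaleR trace_add)
  have "0 \<le> trace (transpose B ** H ** B)"
    by (rule trace_congruence_nonneg) (rule H_psd)
  also have "\<dots> = trace (H ** H ** H) - 4 * trace (H ** H) + 4 * trace H"
    unfolding symB by (simp add: B_def matrix_mult_expand trace_sub trace_scaleR matrix_mul_assoc)
  finally have A: "0 \<le> trace (H ** H ** H) - 4 * trace (H ** H) + 4 * trace H" .
  \<comment> \<open>This is the trace of \<open>H^2 (H - 2)^2 N\<close>, once commutation has moved
    \<open>N\<close> to the right end.\<close>
  have "0 \<le> trace (transpose (H ** B) ** N ** (H ** B))"
    by (rule trace_congruence_nonneg) (rule N_psd)
  also have "transpose (H ** B) ** N ** (H ** B) = (B ** H) ** (N ** H) ** B"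
    by (simp add: matrix_transpose_mul symB \<open>transpose H = H\<close> matrix_mul_assoc)
  also have "\<dots> = (B ** H ** H) ** (N ** B)"
    by (simp only: comm[symmetric] matrix_mul_assoc)
  also have "N ** B = B ** N"
    by (simp add: B_def matrix_mult_expand comm)
  also have "trace ((B ** H ** H) ** (B ** N)) = ?t4 - 4 * ?t3 + 4 * ?t2"
    by (simp add: B_def matrix_mult_expand trace_sub trace_scaleR matrix_mul_assoc)
  finally have "0 \<le> ?t4 - 4 * ?t3 + 4 * ?t2" .
  \<comment> \<open>By the recurrence, \<open>c\<close> times the trace of
    \<open>H (H - 2)^2 N\<close> is the sum of the two nonnegative traces, of
    \<open>H (H - 2)^2\<close> and of \<open>H^2 (H - 2)^2 N\<close>.\<close>
  with A have "0 \<le> c * (?t3 - 4 * ?t2 + 4 * ?t1)"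
    using t1 t2 t3 by (simp add: algebra_simps)
  then have "0 \<le> ?t3 - 4 * ?t2 + 4 * ?t1"
    using \<open>c > 0\<close> by (simp add: zero_le_mult_iff)
  moreover have "?t3 - 4 * ?t2 + 4 * ?t1
      = (c - 2)\<^sup>2 * ?t1 - ((c - 4) * trace H + trace (H ** H))"
  proof -
    have "?t2 = c * ?t1 - trace H" "?t3 = c * (c * ?t1 - trace H) - trace (H ** H)"
      using t1 t2 by (auto simp: algebra_simps)
    then show ?thesis by (simp only:) (simp add: algebra_simps power2_eq_square)
  qed
  ultimately show ?thesis by linarith
qed

text \<open>\<open>A ** X\<close> and \<open>A ** Y\<close> are both the orthogonal projection onto
  the range of \<open>A\<close>, and \<open>X ** A\<close> and \<open>Y ** A\<close> both that onto
  the range of \<open>transpose A\<close>. Hence \<open>Y = Y A Y = X A X = X\<close>, so exhibiting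
  one solution evaluates the definite description.\<close>

lemma moore_penrose_inverse_eqI:
  fixes A :: "real^'n^'m"
  assumes "is_moore_penrose_inverse A X"
  shows "moore_penrose_inverse A = X"
  unfolding moore_penrose_inverse_def
proof (rule the_equality[where a = X])
  show "is_moore_penrose_inverse A X" by fact
next
  fix Y assume "is_moore_penrose_inverse A Y"
  then have Y: "A ** Y ** A = A" "Y ** A ** Y = Y"
      "transpose (A ** Y) = A ** Y" "transpose (Y ** A) = Y ** A"
    by (auto simp: is_moore_penrose_inverse_def)
  have X: "A ** X ** A = A" "X ** A ** X = X"
      "transpose (A ** X) = A ** X" "transpose (X ** A) = X ** A"
    using assms by (auto simp: is_moore_penrose_inverse_def)
  have "A ** Y = transpose ((A ** X) ** (A ** Y))"
    using X(1) Y(3) by (simp add: matrix_mul_assoc)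
  also have "\<dots> = (A ** Y) ** (A ** X)"
    using X(3) Y(3) by (simp only: matrix_transpose_mul[of "A ** X"])
  also have "\<dots> = A ** X"
    using Y(1) by (simp add: matrix_mul_assoc)
  finally have AY: "A ** Y = A ** X" .
  have "Y ** A = transpose ((Y ** A) ** (X ** A))"
    using X(1) Y(4) by (simp add: matrix_mul_assoc[symmetric])
  also have "\<dots> = (X ** A) ** (Y ** A)"
    using X(4) Y(4) by (simp only: matrix_transpose_mul[of "Y ** A"])
  also have "\<dots> = X ** A"
    using Y(1) by (simp add: matrix_mul_assoc[symmetric])
  finally have YA: "Y ** A = X ** A" .
  have "Y = Y ** (A ** Y)" using Y(2) by (simp add: matrix_mul_assoc)
  also have "\<dots> = (X ** A) ** X" by (simp add: AY YA matrix_mul_assoc)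
  finally show "Y = X" using X(2) by simp
qed

section \<open>Quadratic form, kernel and traces of a graph Laplacian; the Laplacian of the complete
  graph minus \<open>F\<close>\<close>

section \<open>Laplacians\<close>

lemma edges_complete_graph: "edges (complete_graph V) = unordered_pairs V"
  by (simp add: edges_def complete_graph_def)

lemma singleton_notin_unordered_pairs: "{x} \<notin> unordered_pairs V"
  by (auto simp: unordered_pairs_def singleton_insert_inj_eq')

lemma doubleton_in_unordered_pairs: "{x, y} \<in> unordered_pairs UNIV \<longleftrightarrow> x \<noteq> y"
  by (auto simp: unordered_pairs_def)

lemma degree_eq_card_neighbours:
  fixes G :: "'v ugraph"
  assumes "edges G \<subseteq> unordered_pairs UNIV"
  shows "degree G x = card {y. {x, y} \<in> edges G}"
proof -
  have "{e \<in> edges G. x \<in> e} = (\<lambda>y. {x, y}) ` {y. {x, y} \<in> edges G}"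
  proof (intro equalityI subsetI)
    fix e assume e: "e \<in> {e \<in> edges G. x \<in> e}"
    then obtain y z where "e = {y, z}" using assms by (auto simp: unordered_pairs_def)
    with e have "e = {x, y} \<or> e = {x, z}" by auto
    with e show "e \<in> (\<lambda>y. {x, y}) ` {y. {x, y} \<in> edges G}" by auto
  qed auto
  moreover have "inj_on (\<lambda>y. {x, y}) {y. {x, y} \<in> edges G}"
    by (auto simp: inj_on_def doubleton_eq_iff)
  ultimately show ?thesis by (simp add: degree_def card_image)
qed

lemma real_degree_eq_sum:
  fixes G :: "'v::finite ugraph"
  assumes "edges G \<subseteq> unordered_pairs UNIV"
  shows "real (degree G x) = (\<Sum>y\<in>UNIV. of_bool ({x, y} \<in> edges G))"
  by (simp add: degree_eq_card_neighbours[OF assms])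

lemma laplacian_mult_vector:
  fixes G :: "'v::finite ugraph"
  assumes "edges G \<subseteq> unordered_pairs UNIV"
  shows "(laplacian G *v u) $ x = (\<Sum>y\<in>UNIV. of_bool ({x, y} \<in> edges G) * (u $ x - u $ y))"
proof -
  have "(laplacian G *v u) $ x = (\<Sum>y\<in>UNIV. (if x = y then real (degree G x) * u $ y else 0)
      - of_bool ({x, y} \<in> edges G) * u $ y)"
    by (auto simp: matrix_vector_mult_def laplacian_def degree_matrix_def adjacency_matrix_def
        algebra_simps intro!: sum.cong)
  also have "\<dots> = real (degree G x) * u $ x - (\<Sum>y\<in>UNIV. of_bool ({x, y} \<in> edges G) * u $ y)"
    by (simp add: sum_subtractf)
  also have "\<dots> = (\<Sum>y\<in>UNIV. of_bool ({x, y} \<in> edges G) * (u $ x - u $ y))"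
    unfolding real_degree_eq_sum[OF assms]
    by (simp add: sum_distrib_right right_diff_distrib sum_subtractf
        del: sum_of_bool_mult_eq sum_of_bool_eq)
  finally show ?thesis .
qed

lemma laplacian_quadratic_form:
  fixes G :: "'v::finite ugraph"
  assumes "edges G \<subseteq> unordered_pairs UNIV"
  shows "u \<bullet> (laplacian G *v u)
    = (\<Sum>x\<in>UNIV. \<Sum>y\<in>UNIV. of_bool ({x, y} \<in> edges G) * (u $ x - u $ y)\<^sup>2) / 2"
proof -
  let ?a = "\<lambda>x y. of_bool ({x, y} \<in> edges G) :: real"
  have eq: "u \<bullet> (laplacian G *v u) = (\<Sum>x\<in>UNIV. \<Sum>y\<in>UNIV. ?a x y * (u $ x - u $ y) * u $ x)"
    by (simp add: inner_vec_def laplacian_mult_vector[OF assms] sum_distrib_left mult_ac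
        del: sum_of_bool_mult_eq sum_mult_of_bool_eq)
  \<comment> \<open>Exchanging the roles of \<open>x\<close> and \<open>y\<close> gives a second
    expression for the same sum; adding both completes the square.\<close>
  also have "\<dots> = (\<Sum>x\<in>UNIV. \<Sum>y\<in>UNIV. ?a x y * (u $ y - u $ x) * u $ y)"
    by (subst sum.swap) (simp add: insert_commute)
  finally have "2 * (u \<bullet> (laplacian G *v u)) = (\<Sum>x\<in>UNIV. \<Sum>y\<in>UNIV.
      ?a x y * (u $ x - u $ y) * u $ x + ?a x y * (u $ y - u $ x) * u $ y)"
    using eq by (simp add: sum.distrib)
  also have "\<dots> = (\<Sum>x\<in>UNIV. \<Sum>y\<in>UNIV. ?a x y * (u $ x - u $ y)\<^sup>2)"
    by (simp add: power2_eq_square algebra_simps)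
  finally show ?thesis by simp
qed

lemma laplacian_psd:
  fixes G :: "'v::finite ugraph"
  assumes "edges G \<subseteq> unordered_pairs UNIV"
  shows "0 \<le> u \<bullet> (laplacian G *v u)"
  unfolding laplacian_quadratic_form[OF assms] by (simp add: sum_nonneg)

lemma transpose_laplacian: "transpose (laplacian G) = laplacian G"
  by (auto simp: vec_eq_iff transpose_def laplacian_def degree_matrix_def adjacency_matrix_def
      insert_commute)

lemma laplacian_mult_ones:
  fixes G :: "'v::finite ugraph"
  assumes "edges G \<subseteq> unordered_pairs UNIV"
  shows "laplacian G ** (\<chi> x y. 1) = (0 :: real^'v^'v)"
proof -
  have "(laplacian G ** (\<chi> x y. 1)) $ x $ y = (laplacian G *v (\<chi> x. 1)) $ x" for x y :: 'v
    by (simp add: matrix_matrix_mult_def matrix_vector_mult_def)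
  then show ?thesis by (simp add: vec_eq_iff laplacian_mult_vector[OF assms])
qed

text \<open>A vanishing sum of squares forces \<open>u\<close> to agree across every edge, hence
  along every walk.\<close>

lemma connected_laplacian_kernel:
  fixes G :: "'v::finite ugraph"
  assumes "edges G \<subseteq> unordered_pairs UNIV" and "connected_graph G" and "verts G = UNIV"
    and "u \<bullet> (laplacian G *v u) = 0"
  shows "u $ x = u $ y"
proof -
  have "(\<Sum>x\<in>UNIV. \<Sum>y\<in>UNIV. of_bool ({x, y} \<in> edges G) * (u $ x - u $ y)\<^sup>2) = 0"
    using assms(4) by (simp add: laplacian_quadratic_form[OF assms(1)])
  then have adj: "u $ x = u $ y" if "{x, y} \<in> edges G" for x y
    using that by (simp add: sum_nonneg_eq_0_iff sum_nonneg)
  have "(x, y) \<in> {(u, v). {u, v} \<in> edges G}\<^sup>*"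
    using assms(2,3) by (auto simp: connected_graph_def)
  then show ?thesis
    by (induction rule: rtrancl_induct) (use adj in auto)
qed

lemma trace_laplacian:
  fixes G :: "'v::finite ugraph"
  assumes "edges G \<subseteq> unordered_pairs UNIV"
  shows "trace (laplacian G) = (\<Sum>x\<in>UNIV. real (degree G x))"
proof -
  have "{x} \<notin> edges G" for x
    using assms singleton_notin_unordered_pairs[of x UNIV] by (metis subsetD)
  then show ?thesis
    by (simp add: trace_def laplacian_def degree_matrix_def adjacency_matrix_def)
qed

text \<open>By symmetry the trace is the sum of the squared entries: row \<open>x\<close>
  contributes the squared degree on the diagonal and 1 for each neighbour.\<close>

lemma trace_laplacian_squared:
  fixes G :: "'v::finite ugraph"
  assumes "edges G \<subseteq> unordered_pairs UNIV"
  shows "trace (laplacian G ** laplacian G)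
    = (\<Sum>x\<in>UNIV. (real (degree G x))\<^sup>2 + real (degree G x))"
proof -
  have no_loop: "{x} \<notin> edges G" for x
    using assms singleton_notin_unordered_pairs[of x UNIV] by (metis subsetD)
  have sym: "laplacian G $ y $ x = laplacian G $ x $ y" for x y
    using transpose_laplacian[of G] unfolding transpose_def vec_eq_iff by simp
  have "trace (laplacian G ** laplacian G)
      = (\<Sum>x\<in>UNIV. \<Sum>y\<in>UNIV. laplacian G $ x $ y * laplacian G $ x $ y)"
    unfolding trace_def matrix_matrix_mult_def by (subst (2) sym) simp
  also have "\<dots> = (\<Sum>x\<in>UNIV. \<Sum>y\<in>UNIV. (if x = y then (real (degree G x))\<^sup>2 else 0)
      + of_bool ({x, y} \<in> edges G))"
    by (intro sum.cong refl)
      (auto simp: laplacian_def degree_matrix_def adjacency_matrix_def power2_eq_square no_loop)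
  finally show ?thesis
    by (simp only: sum.distrib real_degree_eq_sum[OF assms, symmetric]) simp
qed

lemma handshake:
  fixes G :: "'v::finite ugraph"
  assumes "edges G \<subseteq> unordered_pairs UNIV"
  shows "(\<Sum>x\<in>UNIV. degree G x) = 2 * card (edges G)"
proof -
  have "{e \<in> edges G. x \<in> e} = edges G \<inter> {e. x \<in> e}" for x by blast
  then have "(\<Sum>x\<in>UNIV. degree G x) = (\<Sum>x\<in>UNIV. \<Sum>e\<in>edges G. of_bool (x \<in> e))"
    by (simp add: degree_def)
  also have "\<dots> = (\<Sum>e\<in>edges G. card e)"
    by (subst sum.swap) simp
  also have "\<dots> = (\<Sum>e\<in>edges G. 2)"
    using assms by (intro sum.cong) (auto simp: unordered_pairs_def)
  finally show ?thesis by simp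
qed

lemma edges_delete_complete_subset:
  "edges (delete_edges (complete_graph UNIV) F) \<subseteq> unordered_pairs UNIV"
  by (auto simp: delete_edges_def edges_def complete_graph_def)

lemma laplacian_delete_edges_complete:
  fixes F :: "'v::finite set set"
  assumes "F \<subseteq> unordered_pairs UNIV"
  shows "laplacian (delete_edges (complete_graph UNIV) F)
    = real CARD('v) *\<^sub>R mat 1 - (\<chi> x y. 1) - laplacian (UNIV, F)"
proof -
  let ?G = "delete_edges (complete_graph UNIV) F"
  have edges_G: "edges ?G = unordered_pairs UNIV - F"
    by (simp add: delete_edges_def edges_def complete_graph_def)
  have edges_F: "edges (UNIV, F) = F"
    by (simp add: edges_def)
  have no_loop: "{x} \<notin> F" for x
    using assms singleton_notin_unordered_pairs[of x UNIV] by (metis subsetD)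
  \<comment> \<open>The subtraction is exact because edges in \<open>F\<close> have distinct
    endpoints, so at most one of the subtracted indicators is 1.\<close>
  have adj: "of_bool ({x, y} \<in> edges ?G) = 1 - of_bool (x = y) - (of_bool ({x, y} \<in> F) :: real)"
    for x y
    using no_loop[of x] by (auto simp: edges_G doubleton_in_unordered_pairs)
  have deg: "real (degree ?G x) = real CARD('v) - 1 - real (degree (UNIV, F) x)" for x
  proof -
    have "real (degree ?G x)
        = (\<Sum>y\<in>UNIV. 1 - of_bool (x = y) - of_bool ({x, y} \<in> F))"
      by (simp only: real_degree_eq_sum[OF edges_delete_complete_subset] adj)
    also have "\<dots> = real CARD('v) - (\<Sum>y\<in>UNIV. of_bool (x = y))
        - (\<Sum>y\<in>UNIV. of_bool ({x, y} \<in> F))"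
      by (simp only: sum_subtractf) simp
    also have "(\<Sum>y\<in>UNIV. of_bool ({x, y} \<in> F)) = real (degree (UNIV, F) x)"
      using assms by (simp only: real_degree_eq_sum edges_F)
    finally show ?thesis by simp
  qed
  have "laplacian ?G $ x $ y = (if x = y then real (degree ?G x) else 0) - of_bool ({x, y} \<in> edges ?G)"
    for x y
    by (simp add: laplacian_def degree_matrix_def adjacency_matrix_def)
  then show ?thesis
    unfolding vec_eq_iff adj deg
    by (simp add: laplacian_def degree_matrix_def adjacency_matrix_def mat_def edges_F)
qed

section \<open>From effective resistances to the trace of the inverse of
  \<open>L + J\<close>\<close>

section \<open>The Kirchhoff index as a trace\<close>

lemma sum_unordered_pairs:
  fixes f :: "'v::finite set \<Rightarrow> real"
  shows "(\<Sum>(x, y) | x \<noteq> y. f {x, y}) = 2 * (\<Sum>e\<in>unordered_pairs UNIV. f e)"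
proof -
  let ?S = "{(x, y). x \<noteq> y} :: ('v \<times> 'v) set"
  have "(\<Sum>z\<in>?S. f {fst z, snd z})
      = (\<Sum>e\<in>unordered_pairs UNIV. \<Sum>z | z \<in> ?S \<and> {fst z, snd z} = e. f {fst z, snd z})"
    by (intro sum.group[symmetric]) (auto simp: doubleton_in_unordered_pairs)
  also have "\<dots> = (\<Sum>e\<in>unordered_pairs UNIV. 2 * f e)"
  proof (intro sum.cong refl)
    fix e :: "'v set" assume "e \<in> unordered_pairs UNIV"
    then obtain x y where e: "e = {x, y}" "x \<noteq> y" by (auto simp: unordered_pairs_def)
    \<comment> \<open>Each unordered pair arises from exactly two ordered ones, whence the factor
      2.\<close>
    then have "{z. z \<in> ?S \<and> {fst z, snd z} = e} = {(x, y), (y, x)}"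
      by (auto simp: doubleton_eq_iff)
    then show "(\<Sum>z | z \<in> ?S \<and> {fst z, snd z} = e. f {fst z, snd z}) = 2 * f e"
      using e by (simp add: insert_commute)
  qed
  finally show ?thesis by (simp add: case_prod_beta sum_distrib_left)
qed

lemma effective_resistance_entries:
  fixes G :: "'v::finite ugraph"
  defines "X \<equiv> moore_penrose_inverse (laplacian G)"
  shows "effective_resistance G x y = X $ x $ x - X $ x $ y - X $ y $ x + X $ y $ y"
  unfolding effective_resistance_def X_def
  by (simp add: matrix_vector_mult_diff_distrib inner_diff_left inner_axis'
      matrix_vector_mult_basis column_def)

text \<open>Over all ordered pairs, the diagonal entries of \<open>X\<close> contribute
  \<open>2 n tr X\<close>. The mixed terms sum to minus twice the total of all entries, and that
  total is the trace of \<open>X J\<close>, which vanishes.\<close>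

lemma kirchhoff_index_eq_trace:
  fixes G :: "'v::finite ugraph"
  defines "X \<equiv> moore_penrose_inverse (laplacian G)"
  assumes "verts G = UNIV" and "X ** (\<chi> x y. 1) = (0 :: real^'v^'v)"
  shows "kirchhoff_index G = real CARD('v) * trace X"
proof -
  have total: "(\<Sum>x\<in>UNIV. \<Sum>y\<in>UNIV. X $ x $ y) = 0"
    using arg_cong[OF assms(3), of trace]
    by (simp add: trace_def matrix_matrix_mult_def)
  have total': "(\<Sum>x\<in>UNIV. \<Sum>y\<in>UNIV. X $ y $ x) = 0"
    using total by (subst sum.swap)
  have "2 * kirchhoff_index G = (\<Sum>(x, y) | x \<noteq> y. effective_resistance G x y)"
    unfolding kirchhoff_index_def \<open>verts G = UNIV\<close> sum_unordered_pairs[symmetric]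
    by (simp add: pair_resistance_eq)
  also have "\<dots> = (\<Sum>(x, y)\<in>UNIV \<times> UNIV. effective_resistance G x y)"
    \<comment> \<open>Pairs with \<open>x = y\<close> may be added, since their resistance is
      0.\<close>
    by (rule sum.mono_neutral_left) (auto simp: effective_resistance_entries)
  also have "\<dots> = (\<Sum>x\<in>UNIV. \<Sum>y\<in>UNIV. effective_resistance G x y)"
    by (simp only: sum.cartesian_product)
  also have "\<dots> = (\<Sum>x\<in>UNIV. \<Sum>y\<in>UNIV. X $ x $ x + X $ y $ y - X $ x $ y - X $ y $ x)"
    by (simp add: effective_resistance_entries X_def algebra_simps)
  also have "\<dots> = 2 * (real CARD('v) * trace X)"
    by (simp add: sum.distrib sum_subtractf total total' trace_def sum_distrib_left)
  finally show ?thesis by simp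
qed

text \<open>Adding \<open>J\<close> adds the squared coordinate sum to the quadratic form. A kernel
  vector is then constant by connectivity and has sum 0, so it vanishes.\<close>

lemma connected_laplacian_plus_ones_inverse:
  fixes G :: "'v::finite ugraph"
  assumes "edges G \<subseteq> unordered_pairs UNIV" and "connected_graph G" and "verts G = UNIV"
  obtains N where "(laplacian G + (\<chi> x y. 1)) ** N = mat 1"
    "N ** (laplacian G + (\<chi> x y. 1)) = mat 1"
    "transpose N = N" "\<And>v. 0 \<le> v \<bullet> (N *v v)"
proof -
  let ?J = "(\<chi> x y. 1) :: real^'v^'v"
  let ?M = "laplacian G + ?J"
  have form_M: "v \<bullet> (?M *v v) = v \<bullet> (laplacian G *v v) + (\<Sum>x\<in>UNIV. v $ x)\<^sup>2" for v
  proof -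
    have "v \<bullet> (?J *v v) = (\<Sum>x\<in>UNIV. v $ x)\<^sup>2"
      by (simp add: inner_vec_def matrix_vector_mult_def power2_eq_square sum_distrib_right)
    then show ?thesis by (simp add: matrix_vector_mult_add_rdistrib inner_add_right)
  qed
  have sym_M: "transpose ?M = ?M"
    using transpose_laplacian[of G] by (simp add: vec_eq_iff transpose_def)
  have "v = 0" if "?M *v v = 0" for v
  proof -
    have "v \<bullet> (laplacian G *v v) + (\<Sum>x\<in>UNIV. v $ x)\<^sup>2 = 0"
      using form_M[of v] that by simp
    then have "v \<bullet> (laplacian G *v v) = 0" and sum_0: "(\<Sum>x\<in>UNIV. v $ x) = 0"
      using laplacian_psd[OF assms(1), of v]
      by (auto simp: add_nonneg_eq_0_iff)
    then have const: "v $ x = v $ y" for x y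
      using connected_laplacian_kernel[OF assms] by blast
    have "v $ x = 0" for x
    proof -
      have "(\<Sum>y\<in>UNIV. v $ y) = (\<Sum>y\<in>(UNIV :: 'v set). v $ x)"
        using const by (intro sum.cong) auto
      with sum_0 show ?thesis by simp
    qed
    then show ?thesis by (simp add: vec_eq_iff)
  qed
  then obtain N where NM: "N ** ?M = mat 1"
    using matrix_left_invertible_ker by blast
  then have MN: "?M ** N = mat 1"
    using matrix_left_right_inverse by blast
  have "transpose N ** ?M = mat 1"
    using arg_cong[OF MN, of transpose] by (simp add: matrix_transpose_mul sym_M)
  then have symN: "transpose N = N"
    by (metis MN matrix_mul_assoc matrix_mul_lid matrix_mul_rid)
  have "0 \<le> v \<bullet> (N *v v)" for v
  proof -
    \<comment> \<open>The form of \<open>N\<close> at \<open>v\<close> equals the form of its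
      inverse at \<open>N *v v\<close>.\<close>
    have "0 \<le> (N *v v) \<bullet> (?M *v (N *v v))"
      unfolding form_M using laplacian_psd[OF assms(1)] by simp
    also have "?M *v (N *v v) = v"
      by (simp add: matrix_vector_mul_assoc MN)
    finally show ?thesis by (simp add: inner_commute)
  qed
  with NM MN symN show thesis by (intro that)
qed

lemma kirchhoff_index_eq_trace_inverse:
  fixes G :: "'v::finite ugraph"
  assumes "edges G \<subseteq> unordered_pairs UNIV" and "verts G = UNIV"
    and MN: "(laplacian G + (\<chi> x y. 1)) ** N = mat 1"
    and NM: "N ** (laplacian G + (\<chi> x y. 1)) = mat 1"
    and symN: "transpose N = N"
  shows "kirchhoff_index G = real CARD('v) * trace N - 1"
proof -
  let ?n = "real CARD('v)"
  define J where "J = ((\<chi> x y. 1) :: real^'v^'v)"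
  define L where "L = laplacian G"
  \<comment> \<open>On constant vectors \<open>L + J\<close> acts as \<open>n\<close>, so
    \<open>N\<close> acts as \<open>1 / n\<close> there, exactly as \<open>J / n^2\<close> does. The
    difference kills constants and still inverts \<open>L\<close> on zero-sum vectors.\<close>
  define X where "X = N - (1 / ?n\<^sup>2) *\<^sub>R J"
  have symL: "transpose L = L" and symJ: "transpose J = J"
    by (simp_all add: L_def transpose_laplacian) (simp add: J_def transpose_def)
  have LJ: "L ** J = 0"
    unfolding L_def J_def by (rule laplacian_mult_ones[OF assms(1)])
  have JL: "J ** L = 0"
    using arg_cong[OF LJ, of transpose]
    by (simp add: matrix_transpose_mul symL symJ) (simp add: transpose_def vec_eq_iff)
  have JJ: "J ** J = ?n *\<^sub>R J"
    by (simp add: J_def vec_eq_iff matrix_matrix_mult_def)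
  have "?n *\<^sub>R (N ** J) = N ** ((L + J) ** J)"
    by (simp add: matrix_mult_expand LJ JJ)
  also have "\<dots> = J"
    using NM by (simp add: matrix_mul_assoc L_def J_def)
  finally have "(1 / ?n) *\<^sub>R (?n *\<^sub>R (N ** J)) = (1 / ?n) *\<^sub>R J" by simp
  then have NJ: "N ** J = (1 / ?n) *\<^sub>R J" by simp
  have JN: "J ** N = (1 / ?n) *\<^sub>R J"
    using arg_cong[OF NJ, of transpose]
    by (simp add: matrix_transpose_mul symN symJ transpose_scalar)
  have LN: "L ** N = mat 1 - (1 / ?n) *\<^sub>R J"
    using MN JN by (simp add: matrix_add_rdistrib flip: L_def J_def) (simp add: algebra_simps)
  have NL: "N ** L = mat 1 - (1 / ?n) *\<^sub>R J"
    using NM NJ by (simp add: matrix_add_ldistrib flip: L_def J_def) (simp add: algebra_simps)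
  \<comment> \<open>Both products are the orthogonal projection onto the zero-sum vectors, from
    which the Penrose conditions follow.\<close>
  have LX: "L ** X = mat 1 - (1 / ?n) *\<^sub>R J" and XL: "X ** L = mat 1 - (1 / ?n) *\<^sub>R J"
    by (simp_all add: X_def matrix_mult_expand LN NL LJ JL)
  have XJ: "X ** J = 0" and JX: "J ** X = 0"
    by (simp_all add: X_def matrix_mult_expand NJ JN JJ power2_eq_square)
  have "is_moore_penrose_inverse L X"
    unfolding is_moore_penrose_inverse_def LX XL
    by (simp add: matrix_mult_expand JL JX) (simp add: transpose_def vec_eq_iff mat_def J_def)
  then have X: "moore_penrose_inverse (laplacian G) = X"
    unfolding L_def by (rule moore_penrose_inverse_eqI)
  have "kirchhoff_index G = ?n * trace X"
    using kirchhoff_index_eq_trace[OF assms(2)] XJ unfolding X J_def by blast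
  also have "trace X = trace N - 1 / ?n"
    by (simp add: X_def trace_sub trace_scaleR power2_eq_square) (simp add: trace_def J_def)
  finally show ?thesis by (simp add: right_diff_distrib)
qed

section \<open>Matchings: degrees at most 1, unique partners, and isomorphism with copies of an
  edge\<close>

section \<open>Matchings\<close>

lemma degree_le_1_iff:
  fixes F :: "'v::finite set set"
  assumes "F \<subseteq> unordered_pairs UNIV"
  shows "(\<forall>x. degree (UNIV, F) x \<le> 1) \<longleftrightarrow> (\<forall>x y z. {x, y} \<in> F \<longrightarrow> {x, z} \<in> F \<longrightarrow> y = z)"
proof -
  have "degree (UNIV, F) x = card {y. {x, y} \<in> F}" for x
    using degree_eq_card_neighbours[of "(UNIV, F)" x] assms by (simp add: edges_def)
  then show ?thesis by (auto simp: card_le_Suc0_iff_eq)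
qed

text \<open>The images of \<open>y\<close> and \<open>z\<close> are both the other end of the copy
  containing \<open>f x\<close>, so they coincide and injectivity applies.\<close>

lemma matching_if_graph_iso:
  assumes "graph_iso (deletion_graph F) (disjoint_K2s p)"
    and "{x, y} \<in> F" and "{x, z} \<in> F"
  shows "y = z"
proof -
  obtain f where bij: "bij_betw f (\<Union>F) ({..<p} \<times> UNIV)"
    and f: "\<forall>x\<in>\<Union>F. \<forall>y\<in>\<Union>F. {x, y} \<in> F
      \<longleftrightarrow> {f x, f y} \<in> {{(i, False), (i, True)} |i. i < p}"
    using assms(1)
    by (auto simp: graph_iso_def deletion_graph_def disjoint_K2s_def verts_def edges_def)
  have V: "x \<in> \<Union>F" "y \<in> \<Union>F" "z \<in> \<Union>F" using assms(2,3) by auto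
  have "{f x, f y} \<in> {{(i, False), (i, True)} |i. i < p}"
    "{f x, f z} \<in> {{(i, False), (i, True)} |i. i < p}"
    using f V assms(2,3) by blast+
  then have "f y = f z" by (auto simp: doubleton_eq_iff)
  then show ?thesis
    using bij V by (auto simp: bij_betw_def dest: inj_onD)
qed

text \<open>Edges are numbered by \<open>g\<close> and oriented arbitrarily from \<open>c e\<close>
  to \<open>d e\<close>. A vertex is sent to the number of its unique edge together with the end it
  occupies.\<close>

lemma graph_iso_if_matching:
  fixes F :: "'v set set"
  assumes "finite F" and "F \<subseteq> unordered_pairs UNIV"
    and matching: "\<And>x y z. {x, y} \<in> F \<Longrightarrow> {x, z} \<in> F \<Longrightarrow> y = z"
  shows "graph_iso (deletion_graph F) (disjoint_K2s (card F))"
proof -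
  have "\<forall>e\<in>F. \<exists>a. e = {fst a, snd a} \<and> fst a \<noteq> snd a"
  proof
    fix e assume "e \<in> F"
    then obtain x y where "e = {x, y}" "x \<noteq> y" using assms(2) by (auto simp: unordered_pairs_def)
    then show "\<exists>a. e = {fst a, snd a} \<and> fst a \<noteq> snd a" by (intro exI[of _ "(x, y)"]) simp
  qed
  then obtain a where a: "\<forall>e\<in>F. e = {fst (a e), snd (a e)} \<and> fst (a e) \<noteq> snd (a e)"
    by (rule bchoice[THEN exE])
  define c d where "c = (\<lambda>e. fst (a e))" and "d = (\<lambda>e. snd (a e))"
  have cd: "e = {c e, d e}" "c e \<noteq> d e" if "e \<in> F" for e
    using a that unfolding c_def d_def by blast+
  have mem: "x = c e \<or> x = d e" if "e \<in> F" "x \<in> e" for x e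
    using cd(1)[OF that(1)] that(2) by blast
  have cd_in: "c e \<in> e" "d e \<in> e" if "e \<in> F" for e
    using cd(1)[OF that] by blast+
  \<comment> \<open>Edges sharing a vertex coincide, so the edge \<open>E x\<close> chosen below is
    the only one through \<open>x\<close>.\<close>
  have disj: "e = e'" if e: "e \<in> F" "e' \<in> F" "x \<in> e" "x \<in> e'" for x e e'
  proof -
    obtain y where y: "e = {x, y}" using cd(1)[of e] mem[of e x] e by (metis insert_commute)
    obtain z where z: "e' = {x, z}" using cd(1)[of e'] mem[of e' x] e by (metis insert_commute)
    show ?thesis using matching[of x y z] e y z by simp
  qed
  have "\<forall>x\<in>\<Union>F. \<exists>e. e \<in> F \<and> x \<in> e" by blast
  then obtain E where "\<forall>x\<in>\<Union>F. E x \<in> F \<and> x \<in> E x"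
    by (rule bchoice[THEN exE])
  then have E: "E x \<in> F" "x \<in> E x" if "x \<in> \<Union>F" for x
    using that by blast+
  have E_eq: "E x = e" if "e \<in> F" "x \<in> e" for x e
    using disj[of "E x" e x] E[of x] that by blast
  obtain g where g: "bij_betw g F {..<card F}"
    using ex_bij_betw_finite_nat[OF \<open>finite F\<close>] by (auto simp: atLeast0LessThan)
  have g_inj: "e = e'" if "g e = g e'" "e \<in> F" "e' \<in> F" for e e'
    using g that by (auto simp: bij_betw_def dest: inj_onD)
  have g_less: "g e < card F" if "e \<in> F" for e
    using g that by (auto simp: bij_betw_def)
  define f where "f x = (g (E x), x = c (E x))" for x
  have f_end: "f (c e) = (g e, True)" "f (d e) = (g e, False)" if "e \<in> F" for e
    using E_eq[of e "c e"] E_eq[of e "d e"] cd_in[OF that] cd(2)[OF that] that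
    by (auto simp: f_def)
  have "bij_betw f (\<Union>F) ({..<card F} \<times> UNIV)"
  proof (rule bij_betwI')
    fix x y assume xy: "x \<in> \<Union>F" "y \<in> \<Union>F"
    show "f x = f y \<longleftrightarrow> x = y"
    proof
      assume eq: "f x = f y"
      then have "E x = E y" using g_inj E xy by (auto simp: f_def)
      then show "x = y"
        using eq mem[OF E[OF xy(1)]] mem[OF E[OF xy(2)]] by (auto simp: f_def)
    qed simp
  next
    fix x assume "x \<in> \<Union>F"
    then show "f x \<in> {..<card F} \<times> UNIV" using g_less E by (auto simp: f_def)
  next
    fix z :: "nat \<times> bool" assume "z \<in> {..<card F} \<times> UNIV"
    then have "fst z \<in> g ` F" using bij_betw_imp_surj_on[OF g] by auto
    then obtain e where e: "e \<in> F" "fst z = g e" by blast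
    then have "z = f (if snd z then c e else d e)"
      using f_end[OF e(1)] by (auto simp: prod_eq_iff)
    moreover have "(if snd z then c e else d e) \<in> \<Union>F"
      using cd_in[OF e(1)] e(1) by auto
    ultimately show "\<exists>x\<in>\<Union>F. z = f x" by blast
  qed
  moreover have "{x, y} \<in> F \<longleftrightarrow> (\<exists>i<card F. {f x, f y} = {(i, False), (i, True)})"
    if xy: "x \<in> \<Union>F" "y \<in> \<Union>F" for x y
  proof
    assume e: "{x, y} \<in> F"
    have "{f x, f y} = f ` {x, y}" by simp
    also have "\<dots> = f ` {c {x, y}, d {x, y}}" using cd(1)[OF e] by simp
    also have "\<dots> = {(g {x, y}, False), (g {x, y}, True)}" using f_end[OF e] by auto
    finally show "\<exists>i<card F. {f x, f y} = {(i, False), (i, True)}"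
      using g_less[OF e] by blast
  next
    assume "\<exists>i<card F. {f x, f y} = {(i, False), (i, True)}"
    \<comment> \<open>Equal copy numbers put \<open>x\<close> and \<open>y\<close> on one edge;
      distinct images make them its two ends.\<close>
    then have neq: "f x \<noteq> f y" and "fst (f x) = fst (f y)" by (auto simp: doubleton_eq_iff)
    then have Exy: "E x = E y" using g_inj E xy by (auto simp: f_def)
    have Ex: "E x \<in> F" using E xy by blast
    have "x \<noteq> y" using neq by auto
    then have "{x, y} = {c (E x), d (E x)}"
      using mem[OF E[OF xy(1)]] mem[OF E[OF xy(2)]] Exy by auto
    then show "{x, y} \<in> F" using cd(1)[OF Ex] Ex by simp
  qed
  ultimately show ?thesis
    unfolding graph_iso_def deletion_graph_def disjoint_K2s_def verts_def edges_def by auto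
qed

section \<open>The lower bound through the degree defect, and the equality case\<close>

section \<open>The bound\<close>

text \<open>For matched \<open>x\<close> and \<open>y\<close>, the entries of \<open>L u\<close> are
  \<open>u_x - u_y\<close> and its negative, so a second application doubles them; at unmatched
  vertices they are 0. Thus only the eigenvalues 0 and 2 can occur, the nodes of the
  interpolation.\<close>

lemma laplacian_matching_squared:
  fixes F :: "'v::finite set set"
  assumes "F \<subseteq> unordered_pairs UNIV"
    and matching: "\<And>x y z. {x, y} \<in> F \<Longrightarrow> {x, z} \<in> F \<Longrightarrow> y = z"
  shows "laplacian (UNIV, F) ** laplacian (UNIV, F) = 2 *\<^sub>R laplacian (UNIV, F)"
proof -
  have F: "edges (UNIV, F) \<subseteq> unordered_pairs UNIV" using assms(1) by (simp add: edges_def)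
  have L: "(laplacian (UNIV, F) *v u) $ x = (\<Sum>y | {x, y} \<in> F. u $ x - u $ y)" for u x
    unfolding laplacian_mult_vector[OF F]
    by (simp add: edges_def)
  have "(laplacian (UNIV, F) *v (laplacian (UNIV, F) *v u)) $ x = 2 * (laplacian (UNIV, F) *v u) $ x"
    for u x
  proof (cases "\<exists>y. {x, y} \<in> F")
    case True
    then obtain y where y: "{x, y} \<in> F" by blast
    then have "{y, x} \<in> F" by (simp add: insert_commute)
    with y have "{z. {x, z} \<in> F} = {y}" "{z. {y, z} \<in> F} = {x}"
      using matching by blast+
    then show ?thesis by (simp add: L)
  qed (simp add: L)
  then show ?thesis
    by (simp add: matrix_eq vec_eq_iff scaleR_matrix_vector_assoc[symmetric]
        flip: matrix_vector_mul_assoc)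
qed

theorem corollary5p1:
  fixes F :: "'v::finite set set" and n p :: nat
  assumes "CARD('v) = n" and "n \<ge> 3"
    and "F \<subseteq> edges (complete_graph UNIV)" and "card F = p" and "p \<ge> 1"
    and "connected_graph (delete_edges (complete_graph UNIV) F)"
  shows "kirchhoff_index (delete_edges (complete_graph UNIV) F) \<ge> real n - 1 + 2 * real p / (real n - 2)
    \<and> (kirchhoff_index (delete_edges (complete_graph UNIV) F) = real n - 1 + 2 * real p / (real n - 2)
        \<longleftrightarrow> graph_iso (deletion_graph F) (disjoint_K2s p))"
proof -
  let ?G = "delete_edges (complete_graph UNIV) F"
  define H where "H = laplacian (UNIV, F)"
  have F: "F \<subseteq> unordered_pairs UNIV"
    using assms(3) by (simp add: edges_complete_graph)
  then have H_edges: "edges (UNIV, F) \<subseteq> unordered_pairs UNIV" by (simp add: edges_def)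
  have verts_G: "verts ?G = UNIV"
    by (simp add: delete_edges_def complete_graph_def verts_def)
  note edges_G = edges_delete_complete_subset[of F]
  obtain N where MN: "(laplacian ?G + (\<chi> x y. 1)) ** N = mat 1"
    and NM: "N ** (laplacian ?G + (\<chi> x y. 1)) = mat 1"
    and symN: "transpose N = N" and N_psd: "\<And>v. 0 \<le> v \<bullet> (N *v v)"
    using connected_laplacian_plus_ones_inverse[OF edges_G assms(6) verts_G] by metis
  have M: "laplacian ?G + (\<chi> x y. 1) = real n *\<^sub>R mat 1 - H"
    by (simp add: laplacian_delete_edges_complete[OF F] H_def assms(1))
  have resolvent: "real n *\<^sub>R N = mat 1 + H ** N"
    using MN unfolding M by (simp add: matrix_mult_expand algebra_simps)
  have "real n *\<^sub>R N = mat 1 + N ** H"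
    using NM unfolding M by (simp add: matrix_mult_expand algebra_simps)
  with resolvent have comm: "H ** N = N ** H" by simp
  have "real n * trace N = real n + trace (H ** N)"
    using arg_cong[OF resolvent, of trace] by (simp add: trace_scaleR trace_add trace_I assms(1))
  then have Kf: "kirchhoff_index ?G = real n - 1 + trace (H ** N)"
    using kirchhoff_index_eq_trace_inverse[OF edges_G verts_G MN NM symN]
    by (simp add: assms(1))
  have sum_deg: "(\<Sum>x\<in>UNIV. real (degree (UNIV, F) x)) = 2 * real p"
    using handshake[OF H_edges] assms(4) by (simp add: edges_def flip: of_nat_sum)
  then have trace_H: "trace H = 2 * real p"
    by (simp add: H_def trace_laplacian[OF H_edges])
  \<comment> \<open>The excess of \<open>tr H^2\<close> over \<open>4 p\<close>. As the degrees sum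
    to \<open>2 p\<close>, it is a sum of terms \<open>d^2 - d\<close>, nonnegative for natural
    \<open>d\<close> and zero only for \<open>d \<le> 1\<close>.\<close>
  define \<delta> where
    "\<delta> = (\<Sum>x\<in>UNIV. (real (degree (UNIV, F) x))\<^sup>2 - real (degree (UNIV, F) x))"
  have trace_HH: "trace (H ** H) = 4 * real p + \<delta>"
    using sum_deg unfolding H_def trace_laplacian_squared[OF H_edges] \<delta>_def
    by (simp add: sum.distrib sum_subtractf)
  have nonneg: "0 \<le> (real k)\<^sup>2 - real k" for k :: nat
    by (cases k) (auto simp: power2_eq_square algebra_simps)
  have \<delta>_nonneg: "0 \<le> \<delta>"
    unfolding \<delta>_def by (intro sum_nonneg nonneg)
  have \<delta>_0: "\<forall>x. degree (UNIV, F) x \<le> 1" if "\<delta> = 0"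
  proof
    fix x
    have "(real (degree (UNIV, F) x))\<^sup>2 - real (degree (UNIV, F) x) = 0"
      using that unfolding \<delta>_def
      by (subst (asm) sum_nonneg_eq_0_iff)
        (auto simp: power2_eq_square le_square simp flip: of_nat_mult)
    then show "degree (UNIV, F) x \<le> 1" by (auto simp: power2_eq_square)
  qed
  have n2: "real n - 2 > 0" using assms(2) by simp
  have "(real n - 4) * trace H + trace (H ** H) \<le> (real n - 2)\<^sup>2 * trace (H ** N)"
    using assms(2) unfolding H_def
    by (intro trace_psd_resolvent_ge transpose_laplacian comm[unfolded H_def]
        resolvent[unfolded H_def] laplacian_psd[OF H_edges] N_psd) auto
  \<comment> \<open>Here \<open>(n - 4) * 2 p + 4 p = (n - 2) * 2 p\<close>. Keeping \<delta> in the
    estimate makes it settle the equality case as well.\<close>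
  then have "(real n - 2) * (2 * real p) + \<delta> \<le> (real n - 2)\<^sup>2 * trace (H ** N)"
    by (simp add: trace_H trace_HH algebra_simps)
  then have "((real n - 2) * (2 * real p) + \<delta>) / (real n - 2)\<^sup>2 \<le> trace (H ** N)"
    using n2 by (simp add: pos_divide_le_eq mult.commute)
  then have bound: "2 * real p / (real n - 2) + \<delta> / (real n - 2)\<^sup>2 \<le> trace (H ** N)"
    using n2 by (simp add: add_divide_distrib power2_eq_square)
  have defect: "0 \<le> \<delta> / (real n - 2)\<^sup>2" using \<delta>_nonneg by simp
  have eq_matching: "trace (H ** N) = 2 * real p / (real n - 2)"
    if "\<And>x y z. {x, y} \<in> F \<Longrightarrow> {x, z} \<in> F \<Longrightarrow> y = z"
  proof -
    have "H ** H = 2 *\<^sub>R H"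
      unfolding H_def using F that by (rule laplacian_matching_squared)
    \<comment> \<open>With \<open>H^2 = 2 H\<close>, the resolvent identity multiplied by
      \<open>H\<close> closes up into a linear equation for \<open>tr (H N)\<close>, solvable
      because \<open>n\<close> exceeds 2.\<close>
    have "real n *\<^sub>R (H ** N) = H ** (real n *\<^sub>R N)" by (simp add: matrix_scaleR_right)
    also have "\<dots> = H + 2 *\<^sub>R (H ** N)"
      unfolding resolvent
      by (simp add: matrix_add_ldistrib matrix_mul_assoc \<open>H ** H = 2 *\<^sub>R H\<close> matrix_scaleR_left)
    finally have "real n * trace (H ** N) = 2 * real p + 2 * trace (H ** N)"
      using arg_cong[of _ _ trace] by (metis trace_H trace_add trace_scaleR)
    then show ?thesis using n2 by (simp add: field_simps)
  qed
  have "kirchhoff_index ?G = real n - 1 + 2 * real p / (real n - 2)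
      \<longleftrightarrow> graph_iso (deletion_graph F) (disjoint_K2s p)"
  proof
    assume "kirchhoff_index ?G = real n - 1 + 2 * real p / (real n - 2)"
    then have "\<delta> / (real n - 2)\<^sup>2 = 0"
      using bound defect Kf by linarith
    then have "\<delta> = 0" using n2 by simp
    then have "\<forall>x y z. {x, y} \<in> F \<longrightarrow> {x, z} \<in> F \<longrightarrow> y = z"
      using \<delta>_0 degree_le_1_iff[OF F] by blast
    then show "graph_iso (deletion_graph F) (disjoint_K2s p)"
      using graph_iso_if_matching[OF finite F] assms(4) by blast
  next
    assume "graph_iso (deletion_graph F) (disjoint_K2s p)"
    then show "kirchhoff_index ?G = real n - 1 + 2 * real p / (real n - 2)"
      using eq_matching matching_if_graph_iso Kf by metis
  qed
  then show ?thesis using bound defect Kf by linarith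
qed

end
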